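(* Let $n\ge k\ge 2$ be integers. Let $F$ be a $k$-vertex graph and let $G$ be an $n$-vertex graph. Then the $F$-tiling polynomial $m_F(G,x)$ is uniquely determined from $\mathcal{C}\left(G,\left\lfloor\frac{k-1}{k}n\right\rfloor+1\right)$. That is, if $G_1$ and $G_2$ are $n$-vertex graphs with $\mathcal{C}\left(G_1,\left\lfloor\frac{k-1}{k}n\right\rfloor+1\right)=\mathcal{C}\left(G_2,\left\lfloor\frac{k-1}{k}n\right\rfloor+1\right)$, then $m_F(G_1,x)=m_F(G_2,x)$.
   Context: Graphs are finite $2$-uniform hypergraphs (no loops; multi-edges are allowed). A copy of $F$ in $G$ is a (not necessarily induced) subgraph of $G$ isomorphic to $F$; distinct copies may have the same vertex set. An $F$-tiling in $G$ is a set of pairwise vertex-disjoint copies of $F$ in $G$. For a $k$-vertex graph $F$ and an $n$-vertex graph $G$, the $F$-tiling polynomial of $G$ is $$m_F(G,x)=\sum_{i=0}^{\lfloor n/k\rfloor}(-1)^i p_F(G,i)x^{n-ki},$$ where $p_F(G,i)$ is the number of $F$-tilings in $G$ consisting of $i$ vertex-disjoint copies of $F$, and $p_F(G,0)=1$. For an integer $t\ge 0$, $\mathcal{C}(G,t)$ is the multiset of induced $t$-vertex subgraphs of $G$, regarded as unlabeled, i.e. the multiset of isomorphism classes of $G[X]$ as $X$ ranges over all $t$-element subsets of $V(G)$. *)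

theory Defs
  imports Complex_Main "HOL-Library.Multiset" "HOL-Computational_Algebra.Polynomial"
begin

text \<open>Edges carry an identity of their own, so parallel edges are distinct elements of
  \<open>edges\<close> with the same set of end vertices. The value of \<open>ends\<close> outside \<open>edges\<close> is irrelevant.\<close>

record ('v, 'e) multigraph =
  verts :: "'v set"
  edges :: "'e set"
  ends :: "'e \<Rightarrow> 'v set"

definition finite_multigraph :: "('v, 'e) multigraph \<Rightarrow> bool" where
  "finite_multigraph G \<longleftrightarrow>
     finite (verts G) \<and> finite (edges G) \<and>
     (\<forall>e\<in>edges G. ends G e \<subseteq> verts G \<and> card (ends G e) = 2)"

definition isomorphic :: "('v, 'e) multigraph \<Rightarrow> ('w, 'f) multigraph \<Rightarrow> bool" where
  "isomorphic G H \<longleftrightarrow>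
     (\<exists>f g. bij_betw f (verts G) (verts H) \<and> bij_betw g (edges G) (edges H) \<and>
            (\<forall>e\<in>edges G. ends H (g e) = f ` ends G e))"

text \<open>Requiring \<open>ends H = ends G\<close> as total functions makes a subgraph uniquely determined by its
  vertex set and its edge set, so that counting subgraphs as records is correct.\<close>

definition subgraph :: "('v, 'e) multigraph \<Rightarrow> ('v, 'e) multigraph \<Rightarrow> bool" where
  "subgraph H G \<longleftrightarrow>
     verts H \<subseteq> verts G \<and> edges H \<subseteq> edges G \<and> ends H = ends G \<and>
     (\<forall>e\<in>edges H. ends H e \<subseteq> verts H)"

definition induced_subgraph :: "('v, 'e) multigraph \<Rightarrow> 'v set \<Rightarrow> ('v, 'e) multigraph" where
  "induced_subgraph G X =
     \<lparr>verts = X, edges = {e \<in> edges G. ends G e \<subseteq> X}, ends = ends G\<rparr>"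

definition copies :: "('a, 'b) multigraph \<Rightarrow> ('v, 'e) multigraph \<Rightarrow> ('v, 'e) multigraph set" where
  "copies F G = {H. subgraph H G \<and> isomorphic F H}"

definition is_tiling ::
    "('a, 'b) multigraph \<Rightarrow> ('v, 'e) multigraph \<Rightarrow> ('v, 'e) multigraph set \<Rightarrow> bool" where
  "is_tiling F G T \<longleftrightarrow>
     T \<subseteq> copies F G \<and> pairwise (\<lambda>H H'. verts H \<inter> verts H' = {}) T"

definition num_tilings :: "('a, 'b) multigraph \<Rightarrow> ('v, 'e) multigraph \<Rightarrow> nat \<Rightarrow> nat" where
  "num_tilings F G i = card {T. is_tiling F G T \<and> card T = i}"

definition tiling_polynomial :: "('a, 'b) multigraph \<Rightarrow> ('v, 'e) multigraph \<Rightarrow> int poly" where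
  "tiling_polynomial F G =
     (let k = card (verts F); n = card (verts G)
      in \<Sum>i = 0..n div k. monom ((- 1) ^ i * int (num_tilings F G i)) (n - k * i))"

text \<open>Isomorphism classes are taken inside the fixed universe of finite multigraphs on natural
  numbers, which contains an isomorphic copy of every finite multigraph. This makes classes of
  graphs over different types comparable.\<close>

definition iso_class :: "('v, 'e) multigraph \<Rightarrow> (nat, nat) multigraph set" where
  "iso_class H = {K. finite_multigraph K \<and> isomorphic H K}"

definition deck :: "('v, 'e) multigraph \<Rightarrow> nat \<Rightarrow> (nat, nat) multigraph set multiset" where
  "deck G t =
     image_mset (\<lambda>X. iso_class (induced_subgraph G X))
       (mset_set {X. X \<subseteq> verts G \<and> card X = t})"

lemma isomorphic_sym:
  assumes "finite_multigraph G" "isomorphic G H"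
  shows "isomorphic H G"
proof -
  obtain f g where f: "bij_betw f (verts G) (verts H)" and g: "bij_betw g (edges G) (edges H)"
    and e: "\<forall>e\<in>edges G. ends H (g e) = f ` ends G e"
    using assms(2) unfolding isomorphic_def by blast
  let ?f = "inv_into (verts G) f" and ?g = "inv_into (edges G) g"
  have "ends G (?g d) = ?f ` ends H d" if "d \<in> edges H" for d
  proof -
    have d: "?g d \<in> edges G" "g (?g d) = d"
      using that g by (metis bij_betw_def inv_into_into) (metis that g bij_betw_inv_into_right)
    have sub: "ends G (?g d) \<subseteq> verts G"
      using d assms(1) unfolding finite_multigraph_def by blast
    have "ends H d = f ` ends G (?g d)"
      using e d by metis
    then have "?f ` ends H d = ?f ` f ` ends G (?g d)"
      by simp
    also have "\<dots> = ends G (?g d)"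
      using sub f by (metis bij_betw_def inv_into_image_cancel)
    finally show ?thesis by simp
  qed
  moreover have "bij_betw ?f (verts H) (verts G)" "bij_betw ?g (edges H) (edges G)"
    using f g by (auto intro: bij_betw_inv_into)
  ultimately show ?thesis
    unfolding isomorphic_def by blast
qed

lemma isomorphic_trans:
  assumes "isomorphic G H" "isomorphic H K"
  shows "isomorphic G K"
proof -
  obtain f g where f: "bij_betw f (verts G) (verts H)" "bij_betw g (edges G) (edges H)"
    "\<forall>e\<in>edges G. ends H (g e) = f ` ends G e"
    using assms(1) unfolding isomorphic_def by blast
  obtain f' g' where f': "bij_betw f' (verts H) (verts K)" "bij_betw g' (edges H) (edges K)"
    "\<forall>e\<in>edges H. ends K (g' e) = f' ` ends H e"
    using assms(2) unfolding isomorphic_def by blast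
  have "\<forall>e\<in>edges G. ends K ((g' \<circ> g) e) = (f' \<circ> f) ` ends G e"
  proof
    fix e assume "e \<in> edges G"
    moreover from this have "g e \<in> edges H"
      using f(2) by (rule bij_betwE[THEN bspec, rotated])
    ultimately show "ends K ((g' \<circ> g) e) = (f' \<circ> f) ` ends G e"
      using f(3) f'(3) by (simp add: image_comp)
  qed
  then show ?thesis
    unfolding isomorphic_def using bij_betw_trans[OF f(1) f'(1)] bij_betw_trans[OF f(2) f'(2)]
    by blast
qed

lemma iso_class_nonempty:
  assumes "finite_multigraph H"
  shows "iso_class H \<noteq> {}"
proof -
  obtain f :: "_ \<Rightarrow> nat" where f: "inj_on f (verts H)"
    using assms finite_imp_inj_to_nat_seg unfolding finite_multigraph_def by metis
  obtain g :: "_ \<Rightarrow> nat" where g: "inj_on g (edges H)"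
    using assms finite_imp_inj_to_nat_seg unfolding finite_multigraph_def by metis
  define K where "K = \<lparr>verts = f ` verts H, edges = g ` edges H,
    ends = \<lambda>d. f ` ends H (inv_into (edges H) g d)\<rparr>"
  have "card (f ` ends H e) = 2" if "e \<in> edges H" for e
    using that assms f unfolding finite_multigraph_def by (metis card_image inj_on_subset)
  then have "finite_multigraph K"
    using assms g unfolding finite_multigraph_def K_def by (auto simp: inv_into_f_f)
  moreover have "isomorphic H K"
    unfolding isomorphic_def
    by (rule exI[of _ f], rule exI[of _ g]) (use f g in \<open>auto simp: K_def bij_betw_def\<close>)
  ultimately show ?thesis
    unfolding iso_class_def by blast
qed

lemma iso_class_eq_iff:
  assumes "finite_multigraph G" "finite_multigraph H"
  shows "iso_class G = iso_class H \<longleftrightarrow> isomorphic G H"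
proof
  assume "iso_class G = iso_class H"
  then obtain K :: "(nat, nat) multigraph" where "isomorphic G K" "isomorphic H K"
    using iso_class_nonempty[OF assms(1)] unfolding iso_class_def by auto
  then show "isomorphic G H"
    by (metis isomorphic_sym[OF assms(2)] isomorphic_trans)
next
  assume "isomorphic G H"
  then show "iso_class G = iso_class H"
    using isomorphic_trans[of G H] isomorphic_trans[OF isomorphic_sym[OF assms(1)]]
    unfolding iso_class_def by auto
qed

lemma finite_copies:
  assumes "finite_multigraph G"
  shows "finite (copies F G)"
proof (rule finite_subset)
  show "copies F G \<subseteq>
    (\<lambda>(W, D). \<lparr>verts = W, edges = D, ends = ends G\<rparr>) ` (Pow (verts G) \<times> Pow (edges G))"
  proof
    fix H assume "H \<in> copies F G"
    then have "H = (\<lambda>(W, D). \<lparr>verts = W, edges = D, ends = ends G\<rparr>) (verts H, edges H)"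
      "(verts H, edges H) \<in> Pow (verts G) \<times> Pow (edges G)"
      unfolding copies_def subgraph_def by auto
    then show "H \<in> (\<lambda>(W, D). \<lparr>verts = W, edges = D, ends = ends G\<rparr>) `
        (Pow (verts G) \<times> Pow (edges G))"
      by (rule image_eqI)
  qed
  show "finite ((\<lambda>(W, D). \<lparr>verts = W, edges = D, ends = ends G\<rparr>) `
      (Pow (verts G) \<times> Pow (edges G)))"
    using assms unfolding finite_multigraph_def by simp
qed

lemma num_tilings_0:
  assumes "finite_multigraph G"
  shows "num_tilings F G 0 = 1"
proof -
  have "is_tiling F G T \<and> card T = 0 \<longleftrightarrow> T = {}" for T
  proof
    assume T: "is_tiling F G T \<and> card T = 0"
    then have "finite T"
      using finite_subset[OF _ finite_copies[OF assms, of F]] by (simp add: is_tiling_def)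
    then show "T = {}"
      using T by simp
  qed (simp add: is_tiling_def)
  then show ?thesis
    unfolding num_tilings_def by simp
qed

end

theory Submission
  imports Defs "HOL-Library.FuncSet"
begin

text \<open>An \<open>F\<close>-tiling with \<open>i\<close> members is, up to the \<open>i!\<close> ways of ordering it, a tuple of \<open>i\<close> pairwise
  disjoint copies of \<open>F\<close>, so it suffices to reconstruct the number of such tuples for
  \<open>i \<le> n div k\<close>. Let \<open>N M D\<close> be the number of tuples in which every pair of positions in \<open>M\<close> carries
  intersecting copies and every pair in \<open>D\<close> carries disjoint copies. A pair is either disjoint or
  intersecting, so \<open>N M (insert e D) = N M D - N (insert e M) D\<close>
  (\<open>card_tuples_insert_disjoint\<close>); repeated use reduces the disjointness requirements to the
  numbers \<open>N M {}\<close>, in which only intersections are prescribed (\<open>card_tuples_eq\<close>).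

  View \<open>M\<close> as a graph on the positions. If it is disconnected, \<open>N M {}\<close> is the product of the
  corresponding numbers for two smaller sets of positions (\<open>card_tuples_split\<close>). If it is connected,
  each copy after the first, taken in a suitable order, shares a vertex with an earlier one and so
  adds at most \<open>k - 1\<close> new vertices: the \<open>i\<close> copies together cover at most \<open>(k - 1) * i + 1\<close> vertices
  (\<open>card_UN_connected\<close>). Since \<open>i \<le> n / k\<close>, this is at most
  \<open>t = \<lfloor>(k - 1) * n / k\<rfloor> + 1\<close>, the size of the cards; this is where the threshold
  comes from. Tuples covering at most \<open>t\<close> vertices can be counted from the deck by Kelly's double
  counting: a tuple covering \<open>u\<close> vertices occurs in exactly \<open>(n - u) choose (t - u)\<close> cards, so it is
  counted once in total if each occurrence gets the reciprocal weight (\<open>sum_card_weight\<close>), and the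
  weight of a card depends only on its isomorphism class (\<open>card_weight_isomorphic\<close>).\<close>

section \<open>Tuples of copies\<close>

text \<open>The tuples indexed by \<open>I\<close> whose pairs of positions in \<open>M\<close> must meet and whose pairs in \<open>D\<close> must
  be disjoint. Extensionality makes a tuple depend on its values on \<open>I\<close> only, so that
  cardinalities count tuples correctly.\<close>

definition tuples ::
    "('v, 'e) multigraph set \<Rightarrow> 'i set \<Rightarrow> ('i \<times> 'i) set \<Rightarrow> ('i \<times> 'i) set \<Rightarrow>
      ('i \<Rightarrow> ('v, 'e) multigraph) set" where
  "tuples C I M D = {h \<in> I \<rightarrow>\<^sub>E C.
     (\<forall>(a, b)\<in>M. verts (h a) \<inter> verts (h b) \<noteq> {}) \<and>
     (\<forall>(a, b)\<in>D. verts (h a) \<inter> verts (h b) = {})}"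

definition support :: "'i set \<Rightarrow> ('i \<Rightarrow> ('v, 'e) multigraph) \<Rightarrow> 'v set" where
  "support I h = (\<Union>i\<in>I. verts (h i))"

lemma finite_tuples: "finite C \<Longrightarrow> finite I \<Longrightarrow> finite (tuples C I M D)"
  unfolding tuples_def by (simp add: finite_PiE)

lemma copies_induced_subgraph:
  assumes "X \<subseteq> verts G"
  shows "copies F (induced_subgraph G X) = {H \<in> copies F G. verts H \<subseteq> X}"
  using assms unfolding copies_def subgraph_def induced_subgraph_def by fastforce

lemma tuples_induced_subgraph:
  assumes "X \<subseteq> verts G"
  shows "tuples (copies F (induced_subgraph G X)) I M D =
    {h \<in> tuples (copies F G) I M D. support I h \<subseteq> X}"
  unfolding copies_induced_subgraph[OF assms] tuples_def support_def by (auto simp: PiE_iff)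

lemma finite_multigraph_induced_subgraph:
  assumes "finite_multigraph G" "X \<subseteq> verts G"
  shows "finite_multigraph (induced_subgraph G X)"
  using assms unfolding finite_multigraph_def induced_subgraph_def
  by (auto intro: finite_subset)

lemma copies_verts_subset: "H \<in> copies F G \<Longrightarrow> verts H \<subseteq> verts G"
  unfolding copies_def subgraph_def by blast

lemma card_verts_copy: "H \<in> copies F G \<Longrightarrow> card (verts H) = card (verts F)"
  unfolding copies_def isomorphic_def by (auto dest: bij_betw_same_card)

section \<open>Transport along an isomorphism\<close>

text \<open>Vertex and edge sets are pushed forward separately; the vertex map is exported because
  intersections and sizes of unions are all that the weights below depend on.\<close>

lemma isomorphic_bij_copies:
  fixes K :: "('v, 'e) multigraph" and L :: "('w, 'f) multigraph"
  assumes K: "finite_multigraph K" and "isomorphic K L"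
  obtains f \<Phi> where "inj_on f (verts K)" "bij_betw \<Phi> (copies F K) (copies F L)"
    "\<And>H. H \<in> copies F K \<Longrightarrow> verts (\<Phi> H) = f ` verts H"
proof -
  obtain f g where f: "bij_betw f (verts K) (verts L)" and g: "bij_betw g (edges K) (edges L)"
    and fg: "\<forall>e\<in>edges K. ends L (g e) = f ` ends K e"
    using assms(2) unfolding isomorphic_def by blast
  define \<Phi> :: "('v, 'e) multigraph \<Rightarrow> ('w, 'f) multigraph"
    where "\<Phi> H = \<lparr>verts = f ` verts H, edges = g ` edges H, ends = ends L\<rparr>" for H
  have image_copy: "\<Phi> H \<in> copies F L" if H: "H \<in> copies F K" for H
  proof -
    have sub: "verts H \<subseteq> verts K" "edges H \<subseteq> edges K" "ends H = ends K"
      "\<forall>e\<in>edges H. ends H e \<subseteq> verts H" and iso: "isomorphic F H"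
      using H unfolding copies_def subgraph_def by blast+
    have "subgraph (\<Phi> H) L"
      unfolding subgraph_def
    proof (intro conjI ballI)
      show "verts (\<Phi> H) \<subseteq> verts L" "edges (\<Phi> H) \<subseteq> edges L"
        using sub(1,2) bij_betw_imp_surj_on[OF f] bij_betw_imp_surj_on[OF g]
        unfolding \<Phi>_def by (simp_all, blast+)
      fix d assume "d \<in> edges (\<Phi> H)"
      then obtain e where e: "e \<in> edges H" "d = g e" unfolding \<Phi>_def by auto
      then have "ends (\<Phi> H) d = f ` ends H e"
        using fg sub(2,3) by (auto simp: \<Phi>_def)
      then show "ends (\<Phi> H) d \<subseteq> verts (\<Phi> H)"
        using sub(4) e by (auto simp: \<Phi>_def)
    qed (simp add: \<Phi>_def)
    moreover have "isomorphic H (\<Phi> H)"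
      unfolding isomorphic_def
    proof (intro exI conjI)
      show "bij_betw f (verts H) (verts (\<Phi> H))" "bij_betw g (edges H) (edges (\<Phi> H))"
        using sub f g by (auto simp: \<Phi>_def bij_betw_def intro: inj_on_subset)
      show "\<forall>e\<in>edges H. ends (\<Phi> H) (g e) = f ` ends H e"
        using sub fg by (auto simp: \<Phi>_def)
    qed
    ultimately show ?thesis
      using isomorphic_trans[OF iso] unfolding copies_def by blast
  qed
  have "inj_on \<Phi> (copies F K)"
  proof (rule inj_onI)
    fix H H' assume H: "H \<in> copies F K" "H' \<in> copies F K" and eq: "\<Phi> H = \<Phi> H'"
    have "verts H \<subseteq> verts K" "verts H' \<subseteq> verts K" "edges H \<subseteq> edges K" "edges H' \<subseteq> edges K"
      "ends H = ends H'"
      using H unfolding copies_def subgraph_def by auto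
    moreover have "f ` verts H = f ` verts H'" "g ` edges H = g ` edges H'"
      using eq unfolding \<Phi>_def by auto
    moreover have "inj_on f (verts K)" "inj_on g (edges K)"
      using f g by (auto simp: bij_betw_def)
    ultimately have "verts H = verts H'" "edges H = edges H'" "ends H = ends H'"
      by (meson inj_on_image_eq_iff)+
    then show "H = H'" by simp
  qed
  moreover have "\<Phi> ` copies F K = copies F L"
  proof
    show "\<Phi> ` copies F K \<subseteq> copies F L" using image_copy by blast
    show "copies F L \<subseteq> \<Phi> ` copies F K"
    proof
      fix J assume J: "J \<in> copies F L"
      then have sub: "verts J \<subseteq> verts L" "edges J \<subseteq> edges L" "ends J = ends L"
        "\<forall>e\<in>edges J. ends J e \<subseteq> verts J" and iso: "isomorphic F J"
        unfolding copies_def subgraph_def by blast+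
      \<comment> \<open>The preimage is cut out by inverse images; its edges have their ends among its vertices
        because the ends of an image edge are the images of the ends.\<close>
      define H where "H = \<lparr>verts = {v \<in> verts K. f v \<in> verts J},
        edges = {e \<in> edges K. g e \<in> edges J}, ends = ends K\<rparr>"
      have ends_sub: "ends K e \<subseteq> verts K" if "e \<in> edges K" for e
        using that K unfolding finite_multigraph_def by blast
      have vJ: "f ` verts H = verts J" and eJ: "g ` edges H = edges J"
        using sub f g unfolding H_def bij_betw_def by auto
      then have \<Phi>H: "\<Phi> H = J"
        using sub(3) unfolding \<Phi>_def by simp
      have "subgraph H K"
        unfolding subgraph_def
      proof (intro conjI ballI subsetI)
        fix e v assume e: "e \<in> edges H" and v: "v \<in> ends H e"
        then have e': "e \<in> edges K" "g e \<in> edges J" "v \<in> ends K e"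
          unfolding H_def by auto
        then have "f v \<in> ends L (g e)" using fg by auto
        then have "f v \<in> verts J" using sub(3,4) e'(2) by auto
        then show "v \<in> verts H" using ends_sub e' unfolding H_def by auto
      qed (auto simp: H_def)
      moreover have "isomorphic H J"
        unfolding isomorphic_def
      proof (intro exI conjI)
        have "inj_on f (verts H)" "inj_on g (edges H)"
          using f g unfolding H_def bij_betw_def by (auto intro: inj_on_subset)
        then show "bij_betw f (verts H) (verts J)" "bij_betw g (edges H) (edges J)"
          using vJ eJ by (auto simp: bij_betw_def)
        show "\<forall>e\<in>edges H. ends J (g e) = f ` ends H e"
          using sub(3) fg by (auto simp: H_def)
      qed
      moreover have "finite_multigraph H"
        using K calculation(1) unfolding finite_multigraph_def subgraph_def H_def by auto
      ultimately have "H \<in> copies F K"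
        using isomorphic_trans[OF iso isomorphic_sym] unfolding copies_def by blast
      then show "J \<in> \<Phi> ` copies F K" using \<Phi>H by blast
    qed
  qed
  ultimately have "bij_betw \<Phi> (copies F K) (copies F L)"
    unfolding bij_betw_def by blast
  moreover have "inj_on f (verts K)" using f unfolding bij_betw_def by blast
  ultimately show ?thesis
    using that[of f \<Phi>] unfolding \<Phi>_def by simp
qed

section \<open>Counting tuples with small support from the deck\<close>

text \<open>In an \<open>n\<close>-vertex graph, the binomial coefficient is the number of \<open>t\<close>-sets of vertices that
  contain the support of the tuple, that is, the number of cards in which the tuple occurs.\<close>

definition card_weight ::
    "('a, 'b) multigraph \<Rightarrow> 'i set \<Rightarrow> ('i \<times> 'i) set \<Rightarrow> nat \<Rightarrow> nat \<Rightarrow> ('v, 'e) multigraph \<Rightarrow> rat" where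
  "card_weight F I M n t K = (\<Sum>h\<in>tuples (copies F K) I M {}.
     1 / of_nat ((n - card (support I h)) choose (t - card (support I h))))"

lemma card_weight_isomorphic:
  fixes K :: "('v, 'e) multigraph" and L :: "('w, 'f) multigraph"
  assumes K: "finite_multigraph K" and iso: "isomorphic K L" and M: "M \<subseteq> I \<times> I"
  shows "card_weight F I M n t K = card_weight F I M n t L"
proof -
  obtain f \<Phi> where f: "inj_on f (verts K)" and \<Phi>: "bij_betw \<Phi> (copies F K) (copies F L)"
    and verts_\<Phi>: "\<And>H. H \<in> copies F K \<Longrightarrow> verts (\<Phi> H) = f ` verts H"
    using isomorphic_bij_copies[OF K iso] by metis
  let ?\<Psi> = "inv_into (copies F K) \<Phi>"
  let ?to = "\<lambda>h. restrict (\<Phi> \<circ> h) I" and ?back = "\<lambda>h. restrict (?\<Psi> \<circ> h) I"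
  have \<Psi>: "?\<Psi> J \<in> copies F K" "\<Phi> (?\<Psi> J) = J" if "J \<in> copies F L" for J
    using that bij_betwE[OF bij_betw_inv_into[OF \<Phi>]] bij_betw_inv_into_right[OF \<Phi>] by simp_all
  have \<Phi>': "\<Phi> H \<in> copies F L" "?\<Psi> (\<Phi> H) = H" if "H \<in> copies F K" for H
    using that bij_betwE[OF \<Phi>] bij_betw_inv_into_left[OF \<Phi>] by simp_all
  have meet: "verts (\<Phi> H) \<inter> verts (\<Phi> H') = {} \<longleftrightarrow> verts H \<inter> verts H' = {}"
    if "H \<in> copies F K" "H' \<in> copies F K" for H H'
    unfolding verts_\<Phi>[OF that(1)] verts_\<Phi>[OF that(2)]
    using inj_on_image_Int[OF f copies_verts_subset[OF that(1)] copies_verts_subset[OF that(2)]]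
    by (metis image_is_empty)
  have card_support: "card (support I (?to h)) = card (support I h)"
    if "h \<in> I \<rightarrow>\<^sub>E copies F K" for h
  proof -
    have "support I (?to h) = f ` support I h"
      unfolding support_def using that verts_\<Phi> by (auto simp: PiE_iff)
    moreover have "support I h \<subseteq> verts K"
      unfolding support_def using that copies_verts_subset by (fastforce simp: PiE_iff)
    ultimately show ?thesis
      using f card_image inj_on_subset by metis
  qed
  show ?thesis
    unfolding card_weight_def
  proof (rule sum.reindex_bij_witness[where i = ?back and j = ?to])
    fix h assume h: "h \<in> tuples (copies F K) I M {}"
    then have hK: "h \<in> I \<rightarrow>\<^sub>E copies F K" unfolding tuples_def by simp
    show "?back (?to h) = h"
      using hK \<Phi>' by (auto simp: fun_eq_iff PiE_iff extensional_def)
    show "?to h \<in> tuples (copies F L) I M {}"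
      unfolding tuples_def
    proof (intro CollectI conjI ballI)
      show "?to h \<in> I \<rightarrow>\<^sub>E copies F L"
        using hK \<Phi>'(1) by (auto simp: PiE_iff)
      fix ab assume ab: "ab \<in> M"
      obtain a b where ab_eq: "ab = (a, b)" by fastforce
      have "a \<in> I" "b \<in> I" using ab ab_eq M by auto
      moreover from this have "h a \<in> copies F K" "h b \<in> copies F K" using hK by auto
      moreover have "verts (h a) \<inter> verts (h b) \<noteq> {}"
        using h ab ab_eq unfolding tuples_def by auto
      ultimately show "case ab of (a, b) \<Rightarrow> verts (?to h a) \<inter> verts (?to h b) \<noteq> {}"
        using meet[of "h a" "h b"] ab_eq by simp
    qed simp
    show "1 / of_nat ((n - card (support I (?to h))) choose (t - card (support I (?to h)))) =
      (1 / of_nat ((n - card (support I h)) choose (t - card (support I h))) :: rat)"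
      using card_support[OF hK] by simp
  next
    fix h assume h: "h \<in> tuples (copies F L) I M {}"
    then have hL: "h \<in> I \<rightarrow>\<^sub>E copies F L" unfolding tuples_def by simp
    show "?to (?back h) = h"
      using hL \<Psi> by (auto simp: fun_eq_iff PiE_iff extensional_def)
    show "?back h \<in> tuples (copies F K) I M {}"
      unfolding tuples_def
    proof (intro CollectI conjI ballI)
      show "?back h \<in> I \<rightarrow>\<^sub>E copies F K"
        using hL \<Psi>(1) by (auto simp: PiE_iff)
      fix ab assume ab: "ab \<in> M"
      obtain a b where ab_eq: "ab = (a, b)" by fastforce
      have "a \<in> I" "b \<in> I" using ab ab_eq M by auto
      moreover from this have "h a \<in> copies F L" "h b \<in> copies F L" using hL by auto
      moreover have "verts (h a) \<inter> verts (h b) \<noteq> {}"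
        using h ab ab_eq unfolding tuples_def by auto
      ultimately show "case ab of (a, b) \<Rightarrow> verts (?back h a) \<inter> verts (?back h b) \<noteq> {}"
        using meet[of "?\<Psi> (h a)" "?\<Psi> (h b)"] \<Psi> ab_eq by simp
    qed simp
  qed
qed

text \<open>The weight of a card is a function of its isomorphism class, so summing it over all cards is
  a function of the deck. Evaluating it at a representative on natural numbers brings graphs over
  different types to a common function \<open>\<psi>\<close>.\<close>

lemma deck_eq_sum_card_weight_eq:
  fixes G\<^sub>1 :: "('v, 'e) multigraph" and G\<^sub>2 :: "('w, 'f) multigraph"
  assumes G: "finite_multigraph G\<^sub>1" "finite_multigraph G\<^sub>2"
    and deck: "deck G\<^sub>1 t = deck G\<^sub>2 t" and M: "M \<subseteq> I \<times> I"
  shows "(\<Sum>X | X \<subseteq> verts G\<^sub>1 \<and> card X = t. card_weight F I M n t (induced_subgraph G\<^sub>1 X)) =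
    (\<Sum>X | X \<subseteq> verts G\<^sub>2 \<and> card X = t. card_weight F I M n t (induced_subgraph G\<^sub>2 X))"
proof -
  define \<psi> :: "(nat, nat) multigraph set \<Rightarrow> rat"
    where "\<psi> c = card_weight F I M n t (SOME K. K \<in> c)" for c
  have weight: "card_weight F I M n t K = \<psi> (iso_class K)"
    if "finite_multigraph K" for K :: "('x, 'y) multigraph"
  proof -
    have "(SOME L. L \<in> iso_class K) \<in> iso_class K"
      using iso_class_nonempty[OF that] by (simp add: some_in_eq)
    then have "isomorphic K (SOME L. L \<in> iso_class K)"
      unfolding iso_class_def by simp
    then show ?thesis
      unfolding \<psi>_def by (rule card_weight_isomorphic[OF that _ M])
  qed
  have sum_deck: "(\<Sum>X | X \<subseteq> verts G \<and> card X = t. card_weight F I M n t (induced_subgraph G X)) =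
      sum_mset (image_mset \<psi> (deck G t))"
    if "finite_multigraph G" for G :: "('x, 'y) multigraph"
    unfolding deck_def image_mset.compositionality sum_unfold_sum_mset
    by (intro arg_cong[where f = sum_mset] image_mset_cong)
      (use that in \<open>auto simp: weight[OF finite_multigraph_induced_subgraph] finite_multigraph_def\<close>)
  show ?thesis
    using sum_deck[OF G(1)] sum_deck[OF G(2)] deck by simp
qed

lemma card_supersets_of_card:
  assumes V: "finite V" and U: "U \<subseteq> V" "card U \<le> t"
  shows "card {X. X \<subseteq> V \<and> card X = t \<and> U \<subseteq> X} =
    (card V - card U) choose (t - card U)"
proof -
  have finU: "finite U" using U(1) V by (rule finite_subset)
  have "bij_betw (\<lambda>Y. Y \<union> U) {Y. Y \<subseteq> V - U \<and> card Y = t - card U}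
      {X. X \<subseteq> V \<and> card X = t \<and> U \<subseteq> X}"
  proof (rule bij_betw_byWitness[where f' = "\<lambda>X. X - U"])
    show "(\<lambda>Y. Y \<union> U) ` {Y. Y \<subseteq> V - U \<and> card Y = t - card U} \<subseteq>
        {X. X \<subseteq> V \<and> card X = t \<and> U \<subseteq> X}"
    proof clarify
      fix Y assume Y: "Y \<subseteq> V - U" "card Y = t - card U"
      have "finite Y" "Y \<inter> U = {}" using Y V finite_subset[of Y V] by auto
      then have "card (Y \<union> U) = t"
        using Y U finU by (simp add: card_Un_disjoint)
      then show "Y \<union> U \<subseteq> V \<and> card (Y \<union> U) = t \<and> U \<subseteq> Y \<union> U"
        using Y U by auto
    qed
    show "(\<lambda>X. X - U) ` {X. X \<subseteq> V \<and> card X = t \<and> U \<subseteq> X} \<subseteq>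
        {Y. Y \<subseteq> V - U \<and> card Y = t - card U}"
      using finU by (auto simp: card_Diff_subset)
  qed auto
  then have "card {X. X \<subseteq> V \<and> card X = t \<and> U \<subseteq> X} =
      card {Y. Y \<subseteq> V - U \<and> card Y = t - card U}"
    by (rule bij_betw_same_card[symmetric])
  also have "\<dots> = card (V - U) choose (t - card U)"
    using V by (intro n_subsets) simp
  finally show ?thesis
    using finU U(1) by (simp add: card_Diff_subset)
qed

text \<open>Exchanging the sums over cards and tuples, each tuple contributes the number of cards
  containing it times the reciprocal of that number. That number is
  positive because the support has at most \<open>t\<close> vertices and the graph has at least \<open>t\<close>.\<close>

lemma sum_card_weight:
  assumes G: "finite_multigraph G" and I: "finite I" and t: "t \<le> card (verts G)"
    and small: "\<And>h. h \<in> tuples (copies F G) I M {} \<Longrightarrow> card (support I h) \<le> t"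
  shows "(\<Sum>X | X \<subseteq> verts G \<and> card X = t.
      card_weight F I M (card (verts G)) t (induced_subgraph G X)) =
    of_nat (card (tuples (copies F G) I M {}))"
proof -
  let ?V = "verts G" and ?T = "tuples (copies F G) I M {}"
  let ?w = "\<lambda>h. 1 / of_nat ((card ?V - card (support I h)) choose (t - card (support I h))) :: rat"
  have V: "finite ?V" using G unfolding finite_multigraph_def by blast
  have T: "finite ?T" using finite_tuples[OF finite_copies[OF G] I] .
  have "(\<Sum>X | X \<subseteq> ?V \<and> card X = t. card_weight F I M (card ?V) t (induced_subgraph G X)) =
      (\<Sum>X | X \<subseteq> ?V \<and> card X = t. \<Sum>h | h \<in> ?T \<and> support I h \<subseteq> X. ?w h)"
    unfolding card_weight_def by (intro sum.cong refl) (auto simp: tuples_induced_subgraph)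
  also have "\<dots> = (\<Sum>h\<in>?T. \<Sum>X | X \<in> {X. X \<subseteq> ?V \<and> card X = t} \<and> support I h \<subseteq> X. ?w h)"
    using V T by (subst sum.swap_restrict) auto
  also have "\<dots> = (\<Sum>h\<in>?T. 1)"
  proof (rule sum.cong[OF refl])
    fix h assume h: "h \<in> ?T"
    have sub: "support I h \<subseteq> ?V"
      using h copies_verts_subset unfolding tuples_def support_def by (fastforce simp: PiE_iff)
    have "(card ?V - card (support I h)) choose (t - card (support I h)) \<noteq> 0"
      using t by (simp add: binomial_eq_0_iff)
    then show "(\<Sum>X | X \<in> {X. X \<subseteq> ?V \<and> card X = t} \<and> support I h \<subseteq> X. ?w h) = 1"
      using card_supersets_of_card[OF V sub small[OF h]] by (simp add: conj_assoc)
  qed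
  finally show ?thesis by simp
qed

section \<open>Prescribed intersections\<close>

text \<open>Grow a subfamily one set at a time: connectedness always supplies a further set that meets the
  union so far, and this set adds at most \<open>k - 1\<close> new elements.\<close>

lemma card_UN_connected:
  assumes I: "finite I" "I \<noteq> {}"
    and S: "\<And>i. i \<in> I \<Longrightarrow> finite (S i) \<and> card (S i) = k"
    and connected: "\<And>A. A \<subseteq> I \<Longrightarrow> A \<noteq> {} \<Longrightarrow> A \<noteq> I \<Longrightarrow> \<exists>a\<in>A. \<exists>b\<in>I - A. S a \<inter> S b \<noteq> {}"
  shows "card (\<Union>i\<in>I. S i) \<le> (k - 1) * card I + 1"
proof -
  have "\<exists>A\<subseteq>I. card A = m \<and> card (\<Union>i\<in>A. S i) \<le> (k - 1) * m + 1"
    if "1 \<le> m" "m \<le> card I" for m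
    using that
  proof (induction m rule: dec_induct)
    case base
    obtain i where "i \<in> I" using I by blast
    then show ?case using S by (intro exI[of _ "{i}"]) auto
  next
    case (step m)
    then obtain A where A: "A \<subseteq> I" "card A = m" "card (\<Union>i\<in>A. S i) \<le> (k - 1) * m + 1"
      by auto
    have finA: "finite A" using A I finite_subset by blast
    have "A \<noteq> {}" "A \<noteq> I" using A step by auto
    then obtain a b where ab: "a \<in> A" "b \<in> I" "b \<notin> A" "S a \<inter> S b \<noteq> {}"
      using connected[OF A(1)] by blast
    let ?U = "\<Union>i\<in>A. S i"
    have finU: "finite ?U" "finite (S b)" "card (S b) = k" using finA A S ab by auto
    have "?U \<inter> S b \<noteq> {}" using ab by auto
    then have "card (?U \<inter> S b) \<ge> 1"
      using finU by (metis One_nat_def Suc_leI card_gt_0_iff finite_Int)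
    moreover have "card (?U \<union> S b) + card (?U \<inter> S b) = card ?U + k"
      using card_Un_Int[OF finU(1,2)] finU(3) by simp
    moreover have "(k - 1) * Suc m = (k - 1) * m + (k - 1)" by simp
    ultimately have "card (?U \<union> S b) \<le> (k - 1) * Suc m + 1"
      using A(3) by linarith
    moreover have "(\<Union>i\<in>insert b A. S i) = ?U \<union> S b" by auto
    ultimately show ?case
      using A ab finA by (intro exI[of _ "insert b A"]) auto
  qed
  from this[of "card I"] obtain A where "A \<subseteq> I" "card A = card I"
    "card (\<Union>i\<in>A. S i) \<le> (k - 1) * card I + 1"
    using I by (auto simp: Suc_le_eq card_gt_0_iff)
  moreover from this have "A = I" using I card_subset_eq by blast
  ultimately show ?thesis by simp
qed

text \<open>Without requirements between \<open>A\<close> and \<open>B\<close>, the restrictions of a tuple to \<open>A\<close> and to \<open>B\<close> can be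
  chosen independently.\<close>

lemma card_tuples_split:
  assumes I: "I = A \<union> B" "A \<inter> B = {}" and M: "M \<subseteq> A \<times> A \<union> B \<times> B"
  shows "card (tuples C I M {}) =
    card (tuples C A (M \<inter> A \<times> A) {}) * card (tuples C B (M \<inter> B \<times> B) {})"
proof -
  let ?join = "\<lambda>(p, q) i. if i \<in> A then p i else q i"
  have "bij_betw (\<lambda>h. (restrict h A, restrict h B)) (tuples C I M {})
      (tuples C A (M \<inter> A \<times> A) {} \<times> tuples C B (M \<inter> B \<times> B) {})"
  proof (rule bij_betw_byWitness[where f' = ?join])
    show "\<forall>h\<in>tuples C I M {}. ?join (restrict h A, restrict h B) = h"
      using I by (auto simp: tuples_def fun_eq_iff PiE_iff extensional_def)
    show "\<forall>pq\<in>tuples C A (M \<inter> A \<times> A) {} \<times> tuples C B (M \<inter> B \<times> B) {}.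
        (restrict (?join pq) A, restrict (?join pq) B) = pq"
      using I by (auto simp: tuples_def fun_eq_iff PiE_iff extensional_def)
    show "(\<lambda>h. (restrict h A, restrict h B)) ` tuples C I M {} \<subseteq>
        tuples C A (M \<inter> A \<times> A) {} \<times> tuples C B (M \<inter> B \<times> B) {}"
      using I by (auto simp: tuples_def PiE_iff)
    show "?join ` (tuples C A (M \<inter> A \<times> A) {} \<times> tuples C B (M \<inter> B \<times> B) {}) \<subseteq>
        tuples C I M {}"
    proof (rule image_subsetI)
      fix pq assume "pq \<in> tuples C A (M \<inter> A \<times> A) {} \<times> tuples C B (M \<inter> B \<times> B) {}"
      then obtain p q where pq: "pq = (p, q)" and
        p: "p \<in> tuples C A (M \<inter> A \<times> A) {}" and q: "q \<in> tuples C B (M \<inter> B \<times> B) {}"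
        by blast
      let ?h = "?join (p, q)"
      have hA: "?h i = p i" if "i \<in> A" for i using that by simp
      have hB: "?h i = q i" if "i \<in> B" for i using that I by auto
      have "?h \<in> I \<rightarrow>\<^sub>E C"
        using p q I by (auto simp: tuples_def PiE_iff extensional_def)
      moreover have "verts (?h a) \<inter> verts (?h b) \<noteq> {}" if ab: "(a, b) \<in> M" for a b
      proof -
        consider "(a, b) \<in> M \<inter> A \<times> A" | "(a, b) \<in> M \<inter> B \<times> B" using ab M by blast
        then show ?thesis
        proof cases
          case 1
          then have "verts (p a) \<inter> verts (p b) \<noteq> {}" using p unfolding tuples_def by blast
          then show ?thesis using 1 hA by simp
        next
          case 2
          then have "verts (q a) \<inter> verts (q b) \<noteq> {}" using q unfolding tuples_def by blast
          then show ?thesis using 2 hB[of a] hB[of b] by auto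
        qed
      qed
      ultimately show "?join pq \<in> tuples C I M {}"
        unfolding tuples_def pq by blast
    qed
  qed
  then show ?thesis
    by (simp add: bij_betw_same_card card_cartesian_product)
qed

text \<open>Induction on the number of positions: a disconnected requirement graph \<open>M\<close> splits the count
  into two smaller ones, and a connected one forces the support to fit into a card.\<close>

lemma card_tuples_meeting_eq:
  fixes G\<^sub>1 :: "('v, 'e) multigraph" and G\<^sub>2 :: "('w, 'f) multigraph"
  assumes G: "finite_multigraph G\<^sub>1" "finite_multigraph G\<^sub>2"
    and card_eq: "card (verts G\<^sub>1) = card (verts G\<^sub>2)"
    and deck: "deck G\<^sub>1 t = deck G\<^sub>2 t" and t: "t \<le> card (verts G\<^sub>2)"
    and F: "card (verts F) = k" "k \<ge> 1"
    and I: "finite I" "(k - 1) * card I + 1 \<le> t" and M: "M \<subseteq> I \<times> I"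
  shows "card (tuples (copies F G\<^sub>1) I M {}) = card (tuples (copies F G\<^sub>2) I M {})"
  using I M
proof (induction "card I" arbitrary: I M rule: less_induct)
  case less
  note I = less.prems(1,2) and M = less.prems(3)
  show ?case
  proof (cases "\<exists>A\<subseteq>I. A \<noteq> {} \<and> A \<noteq> I \<and> M \<subseteq> A \<times> A \<union> (I - A) \<times> (I - A)")
    case True
    then obtain A where A: "A \<subseteq> I" "A \<noteq> {}" "A \<noteq> I" "M \<subseteq> A \<times> A \<union> (I - A) \<times> (I - A)"
      by blast
    let ?B = "I - A"
    have smaller: "card A < card I" "card ?B < card I"
      using A I(1) by (auto intro!: psubset_card_mono)
    have bound: "(k - 1) * c + 1 \<le> t" if "c < card I" for c
    proof -
      have "(k - 1) * c \<le> (k - 1) * card I" using that by (intro mult_le_mono2) simp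
      then show ?thesis using I(2) by linarith
    qed
    have split: "card (tuples C I M {}) =
        card (tuples C A (M \<inter> A \<times> A) {}) * card (tuples C ?B (M \<inter> ?B \<times> ?B) {})"
      for C :: "('x, 'y) multigraph set"
      using A by (intro card_tuples_split) auto
    show ?thesis
      unfolding split
      using less.hyps[OF smaller(1) _ bound[OF smaller(1)], of "M \<inter> A \<times> A"]
        less.hyps[OF smaller(2) _ bound[OF smaller(2)], of "M \<inter> ?B \<times> ?B"]
        finite_subset[OF A(1) I(1)] I(1) by simp
  next
    case False
    have small: "card (support I h) \<le> t"
      if G: "finite_multigraph G" and h: "h \<in> tuples (copies F G) I M {}"
      for G :: "('x, 'y) multigraph" and h
    proof (cases "I = {}")
      case True
      then show ?thesis by (simp add: support_def)
    next
      case nonempty: False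
      have "card (\<Union>i\<in>I. verts (h i)) \<le> (k - 1) * card I + 1"
      proof (rule card_UN_connected[OF I(1) nonempty])
        fix i assume "i \<in> I"
        then have "h i \<in> copies F G" using h unfolding tuples_def by auto
        then have "card (verts (h i)) = k" using F(1) card_verts_copy by metis
        then show "finite (verts (h i)) \<and> card (verts (h i)) = k"
          using F(2) card.infinite by fastforce
      next
        fix A assume "A \<subseteq> I" "A \<noteq> {}" "A \<noteq> I"
        then have "\<not> M \<subseteq> A \<times> A \<union> (I - A) \<times> (I - A)"
          using False by blast
        then obtain a b where ab: "(a, b) \<in> M" "(a, b) \<notin> A \<times> A \<union> (I - A) \<times> (I - A)"
          by (meson subrelI)
        have "verts (h a) \<inter> verts (h b) \<noteq> {}"
          using h ab(1) unfolding tuples_def by auto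
        moreover have "a \<in> A \<and> b \<in> I - A \<or> b \<in> A \<and> a \<in> I - A"
          using ab M by blast
        ultimately show "\<exists>a\<in>A. \<exists>b\<in>I - A. verts (h a) \<inter> verts (h b) \<noteq> {}"
          by blast
      qed
      then show ?thesis using I(2) unfolding support_def by linarith
    qed
    have "(\<Sum>X | X \<subseteq> verts G\<^sub>1 \<and> card X = t.
        card_weight F I M (card (verts G\<^sub>1)) t (induced_subgraph G\<^sub>1 X)) =
      of_nat (card (tuples (copies F G\<^sub>1) I M {}))"
      by (rule sum_card_weight[OF G(1) I(1) _ small[OF G(1)]]) (simp_all add: card_eq t)
    moreover have "(\<Sum>X | X \<subseteq> verts G\<^sub>2 \<and> card X = t.
        card_weight F I M (card (verts G\<^sub>2)) t (induced_subgraph G\<^sub>2 X)) =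
      of_nat (card (tuples (copies F G\<^sub>2) I M {}))"
      by (rule sum_card_weight[OF G(2) I(1) t small[OF G(2)]])
    ultimately have "(of_nat (card (tuples (copies F G\<^sub>1) I M {})) :: rat) =
        of_nat (card (tuples (copies F G\<^sub>2) I M {}))"
      using deck_eq_sum_card_weight_eq[OF G deck M, of F "card (verts G\<^sub>2)"] card_eq by simp
    then show ?thesis by simp
  qed
qed

section \<open>From intersections to tilings\<close>

lemma card_tuples_insert_disjoint:
  assumes "finite C" "finite I"
  shows "card (tuples C I M (insert e D)) + card (tuples C I (insert e M) D) =
    card (tuples C I M D)"
proof -
  have "tuples C I M D = tuples C I M (insert e D) \<union> tuples C I (insert e M) D"
    "tuples C I M (insert e D) \<inter> tuples C I (insert e M) D = {}"
    unfolding tuples_def by auto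
  then show ?thesis
    using assms by (simp add: card_Un_disjoint finite_tuples)
qed

text \<open>Induction on \<open>D\<close> with \<open>M\<close> arbitrary, since removing a pair from \<open>D\<close> also leads to a count in
  which that pair has moved to \<open>M\<close>.\<close>

lemma card_tuples_eq:
  fixes G\<^sub>1 :: "('v, 'e) multigraph" and G\<^sub>2 :: "('w, 'f) multigraph"
  assumes G: "finite_multigraph G\<^sub>1" "finite_multigraph G\<^sub>2"
    and meeting: "\<And>M. M \<subseteq> I \<times> I \<Longrightarrow>
      card (tuples (copies F G\<^sub>1) I M {}) = card (tuples (copies F G\<^sub>2) I M {})"
    and I: "finite I" and MD: "M \<subseteq> I \<times> I" "D \<subseteq> I \<times> I"
  shows "card (tuples (copies F G\<^sub>1) I M D) = card (tuples (copies F G\<^sub>2) I M D)"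
proof -
  have "finite D" using I MD finite_subset by blast
  then show ?thesis
    using MD
  proof (induction D arbitrary: M)
    case empty
    then show ?case by (simp add: meeting)
  next
    case (insert e D)
    then have "card (tuples (copies F G\<^sub>1) I M D) = card (tuples (copies F G\<^sub>2) I M D)"
      "card (tuples (copies F G\<^sub>1) I (insert e M) D) = card (tuples (copies F G\<^sub>2) I (insert e M) D)"
      by simp_all
    then show ?case
      using card_tuples_insert_disjoint[OF finite_copies[OF G(1)] I, of F M e D]
        card_tuples_insert_disjoint[OF finite_copies[OF G(2)] I, of F M e D] by simp
  qed
qed

lemma card_bijections_lessThan:
  assumes "finite T"
  shows "card {h \<in> {..<card T} \<rightarrow>\<^sub>E T. inj_on h {..<card T}} = fact (card T)"
  using card_inj_on_subset_funcset[of "{..<card T}" T "{..<card T}"] assms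
  by (simp add: fact_prod_rev)

text \<open>Copies at different positions of a disjoint tuple differ because copies have vertices, so the
  tuple is an injective enumeration of its image; each tiling has \<open>i!\<close> enumerations.\<close>

lemma num_tilings_fact:
  fixes G :: "('v, 'e) multigraph"
  assumes G: "finite_multigraph G" and F: "verts F \<noteq> {}"
  shows "num_tilings F G i * fact i =
    card (tuples (copies F G) {..<i} {} {(a, b). a < i \<and> b < i \<and> a \<noteq> b})"
proof -
  let ?D = "{(a, b). a < i \<and> b < i \<and> a \<noteq> b}"
  let ?T = "{T. is_tiling F G T \<and> card T = i}"
  let ?fun = "\<lambda>T. {h \<in> {..<i} \<rightarrow>\<^sub>E T. inj_on h {..<i}}"
  have fin: "finite T" if "T \<subseteq> copies F G" for T
    using that finite_copies[OF G] finite_subset by blast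
  have image: "h ` {..<i} = T" if "T \<in> ?T" "h \<in> ?fun T" for T h
  proof (rule card_subset_eq)
    show "finite T" using fin that unfolding is_tiling_def by blast
    show "h ` {..<i} \<subseteq> T" using that by auto
    show "card (h ` {..<i}) = card T" using that by (simp add: card_image)
  qed
  have "tuples (copies F G) {..<i} {} ?D = (\<Union>T\<in>?T. ?fun T)"
  proof (intro equalityI subsetI)
    fix h assume h: "h \<in> tuples (copies F G) {..<i} {} ?D"
    have hC: "h \<in> {..<i} \<rightarrow>\<^sub>E copies F G" using h unfolding tuples_def by blast
    have disj: "verts (h a) \<inter> verts (h b) = {}" if "a < i" "b < i" "a \<noteq> b" for a b
      using h that unfolding tuples_def by auto
    have nonempty: "verts (h a) \<noteq> {}" if "a < i" for a
    proof -
      have "isomorphic F (h a)" using hC that unfolding copies_def by auto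
      then show ?thesis using F unfolding isomorphic_def bij_betw_def by auto
    qed
    have inj: "inj_on h {..<i}"
      by (rule inj_onI) (metis disj nonempty Int_absorb lessThan_iff)
    have "pairwise (\<lambda>H H'. verts H \<inter> verts H' = {}) (h ` {..<i})"
      using disj by (auto simp: pairwise_def)
    then have "h ` {..<i} \<in> ?T"
      using hC inj unfolding is_tiling_def by (auto simp: card_image)
    moreover have "h \<in> ?fun (h ` {..<i})"
      using inj hC by (auto simp: PiE_iff)
    ultimately show "h \<in> (\<Union>T\<in>?T. ?fun T)" by blast
  next
    fix h assume "h \<in> (\<Union>T\<in>?T. ?fun T)"
    then obtain T where T: "is_tiling F G T" and h: "h \<in> {..<i} \<rightarrow>\<^sub>E T" and inj: "inj_on h {..<i}"
      by blast
    have "verts (h a) \<inter> verts (h b) = {}" if "a < i" "b < i" "a \<noteq> b" for a b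
    proof -
      have "h a \<in> T" "h b \<in> T" using h that by auto
      moreover have "h a \<noteq> h b" using inj that by (auto dest: inj_onD)
      ultimately show ?thesis
        using T unfolding is_tiling_def by (auto dest: pairwiseD)
    qed
    moreover have "h \<in> {..<i} \<rightarrow>\<^sub>E copies F G"
      using h T unfolding is_tiling_def by (auto simp: PiE_iff)
    ultimately show "h \<in> tuples (copies F G) {..<i} {} ?D"
      unfolding tuples_def by blast
  qed
  moreover have "card (\<Union>T\<in>?T. ?fun T) = (\<Sum>T\<in>?T. card (?fun T))"
  proof (rule card_UN_disjoint)
    show "finite ?T"
      by (rule finite_subset[of _ "Pow (copies F G)"])
        (auto simp: is_tiling_def finite_copies[OF G])
    show "\<forall>T\<in>?T. finite (?fun T)"
    proof
      fix T assume "T \<in> ?T"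
      then have "finite T" using fin unfolding is_tiling_def by blast
      then have "finite ({..<i} \<rightarrow>\<^sub>E T)" by (simp add: finite_PiE)
      then show "finite (?fun T)" by simp
    qed
    show "\<forall>T\<in>?T. \<forall>T'\<in>?T. T \<noteq> T' \<longrightarrow> ?fun T \<inter> ?fun T' = {}"
    proof (intro ballI impI equals0I)
      fix T T' h assume "T \<in> ?T" "T' \<in> ?T" "T \<noteq> T'" "h \<in> ?fun T \<inter> ?fun T'"
      then show False using image[of T h] image[of T' h] by simp
    qed
  qed
  moreover have "card (?fun T) = fact i" if "T \<in> ?T" for T
    using card_bijections_lessThan[of T] fin that unfolding is_tiling_def by auto
  ultimately show ?thesis
    unfolding num_tilings_def by simp
qed

theorem corollary1p6:
  fixes F :: "('a, 'b) multigraph"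
    and G\<^sub>1 :: "('v, 'e) multigraph"
    and G\<^sub>2 :: "('w, 'f) multigraph"
    and n k :: nat
  assumes "k \<ge> 2" and "n \<ge> k"
    and "finite_multigraph F" and "card (verts F) = k"
    and "finite_multigraph G\<^sub>1" and "card (verts G\<^sub>1) = n"
    and "finite_multigraph G\<^sub>2" and "card (verts G\<^sub>2) = n"
    and "deck G\<^sub>1 (nat \<lfloor>(real k - 1) / real k * real n\<rfloor> + 1) =
         deck G\<^sub>2 (nat \<lfloor>(real k - 1) / real k * real n\<rfloor> + 1)"
  shows "tiling_polynomial F G\<^sub>1 = tiling_polynomial F G\<^sub>2"
proof -
  define x where "x = (real k - 1) / real k * real n"
  define t where "t = nat \<lfloor>x\<rfloor> + 1"
  have k: "real k > 0" and n: "real n > 0" using assms(1,2) by auto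
  have "x * real k < real n * real k"
    using k n by (simp add: x_def field_simps)
  then have "x < real n" using k by simp
  then have t_le: "t \<le> n" using n unfolding t_def by linarith
  \<comment> \<open>\<open>(k - 1) * i\<close> is an integer not exceeding \<open>x\<close>, hence not exceeding its floor.\<close>
  have bound: "(k - 1) * i + 1 \<le> t" if "i \<le> n div k" for i
  proof -
    have "i * k \<le> n" using that k by (simp add: less_eq_div_iff_mult_less_eq)
    then have "real i * real k \<le> real n" by (metis of_nat_le_iff of_nat_mult)
    then have "real i \<le> real n / real k" using k by (simp add: field_simps)
    then have "(real k - 1) * real i \<le> (real k - 1) * (real n / real k)"
      using assms(1) by (intro mult_left_mono) auto
    then have "real ((k - 1) * i) \<le> x"
      using assms(1) by (simp add: x_def of_nat_diff)
    then show ?thesis unfolding t_def by linarith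
  qed
  have deck: "deck G\<^sub>1 t = deck G\<^sub>2 t"
    using assms(9) unfolding t_def x_def .
  have card_eq: "card (verts G\<^sub>1) = card (verts G\<^sub>2)" and t_le2: "t \<le> card (verts G\<^sub>2)"
    using assms(6,8) t_le by simp_all
  have k1: "k \<ge> 1" using assms(1) by simp
  have F: "verts F \<noteq> {}" using assms(1,4) by auto
  have "num_tilings F G\<^sub>1 i = num_tilings F G\<^sub>2 i" if i: "i \<le> n div k" for i
  proof -
    have meeting: "card (tuples (copies F G\<^sub>1) {..<i} M {}) = card (tuples (copies F G\<^sub>2) {..<i} M {})"
      if "M \<subseteq> {..<i} \<times> {..<i}" for M
    proof (rule card_tuples_meeting_eq[OF assms(5,7) card_eq deck t_le2 assms(4) k1 _ _ that])
      show "(k - 1) * card {..<i} + 1 \<le> t" using bound[OF i] by simp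
    qed simp
    have "card (tuples (copies F G\<^sub>1) {..<i} {} {(a, b). a < i \<and> b < i \<and> a \<noteq> b}) =
        card (tuples (copies F G\<^sub>2) {..<i} {} {(a, b). a < i \<and> b < i \<and> a \<noteq> b})"
      by (rule card_tuples_eq[OF assms(5,7) meeting]) auto
    then have "num_tilings F G\<^sub>1 i * fact i = num_tilings F G\<^sub>2 i * fact i"
      by (simp only: num_tilings_fact[OF assms(5) F] num_tilings_fact[OF assms(7) F])
    then show ?thesis by simp
  qed
  then show ?thesis
    unfolding tiling_polynomial_def Let_def assms(4,6,8)
    by (intro sum.cong refl) simp
qed

end
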